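(* A Dedekind domain is a PRINC domain if and only if it is a principal ideal domain.
   Context: Two elements $a,b$ of an integral domain $R$ form an idempotent pair if either $a(1-a)\in bR$ or $b(1-b)\in aR$. $R$ is a PRINC domain if every ideal of $R$ generated by an idempotent pair is principal. *)

theory Defs
  imports "HOL-Algebra.Algebra"
begin

section \<open>The field of fractions of a domain\<close>

definition frac_rel :: "('a, 'b) ring_scheme \<Rightarrow> (('a \<times> 'a) \<times> ('a \<times> 'a)) set" where
  "frac_rel R = {((a, b), (c, d)). a \<in> carrier R \<and> b \<in> carrier R - {\<zero>\<^bsub>R\<^esub>} \<and>
     c \<in> carrier R \<and> d \<in> carrier R - {\<zero>\<^bsub>R\<^esub>} \<and> a \<otimes>\<^bsub>R\<^esub> d = c \<otimes>\<^bsub>R\<^esub> b}"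

definition frac_of :: "('a, 'b) ring_scheme \<Rightarrow> 'a \<Rightarrow> 'a \<Rightarrow> ('a \<times> 'a) set" where
  "frac_of R a b = frac_rel R `` {(a, b)}"

text \<open>The unions below range over all representatives; they are taken over constant
  families, as shown by \<open>frac_add\<close> and \<open>frac_mult\<close>.\<close>

definition frac_field :: "('a, 'b) ring_scheme \<Rightarrow> ('a \<times> 'a) set ring" where
  "frac_field R =
     \<lparr> carrier = (carrier R \<times> (carrier R - {\<zero>\<^bsub>R\<^esub>})) // frac_rel R,
       monoid.mult = (\<lambda>x y. \<Union>p \<in> x. \<Union>q \<in> y.
                frac_of R (fst p \<otimes>\<^bsub>R\<^esub> fst q) (snd p \<otimes>\<^bsub>R\<^esub> snd q)),
       one = frac_of R \<one>\<^bsub>R\<^esub> \<one>\<^bsub>R\<^esub>,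
       ring.zero = frac_of R \<zero>\<^bsub>R\<^esub> \<one>\<^bsub>R\<^esub>,
       add = (\<lambda>x y. \<Union>p \<in> x. \<Union>q \<in> y.
                frac_of R (fst p \<otimes>\<^bsub>R\<^esub> snd q \<oplus>\<^bsub>R\<^esub> fst q \<otimes>\<^bsub>R\<^esub> snd p) (snd p \<otimes>\<^bsub>R\<^esub> snd q)) \<rparr>"

definition to_frac :: "('a, 'b) ring_scheme \<Rightarrow> 'a \<Rightarrow> ('a \<times> 'a) set" where
  "to_frac R a = frac_of R a \<one>\<^bsub>R\<^esub>"

context domain
begin

lemma frac_rel_equiv: "equiv (carrier R \<times> (carrier R - {\<zero>})) (frac_rel R)"
proof (rule equivI)
  show "frac_rel R \<subseteq> (carrier R \<times> (carrier R - {\<zero>})) \<times> (carrier R \<times> (carrier R - {\<zero>}))"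
    by (auto simp: frac_rel_def)
  show "refl_on (carrier R \<times> (carrier R - {\<zero>})) (frac_rel R)"
    by (auto simp: refl_on_def frac_rel_def)
  show "sym (frac_rel R)"
    by (auto simp: sym_def frac_rel_def)
  show "trans (frac_rel R)"
  proof (rule transI)
    fix x y z assume xy: "(x, y) \<in> frac_rel R" and yz: "(y, z) \<in> frac_rel R"
    obtain a b where x: "x = (a, b)" by force
    obtain c d where y: "y = (c, d)" by force
    obtain e f where z: "z = (e, f)" by force
    have C: "a \<in> carrier R" "b \<in> carrier R" "c \<in> carrier R" "d \<in> carrier R"
      "e \<in> carrier R" "f \<in> carrier R" "b \<noteq> \<zero>" "d \<noteq> \<zero>" "f \<noteq> \<zero>"
      and 1: "a \<otimes> d = c \<otimes> b" and 2: "c \<otimes> f = e \<otimes> d"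
      using xy yz by (auto simp: x y z frac_rel_def)
    have "d \<otimes> (a \<otimes> f) = (a \<otimes> d) \<otimes> f" using C by algebra
    also have "\<dots> = (c \<otimes> f) \<otimes> b" using C unfolding 1 by algebra
    also have "\<dots> = d \<otimes> (e \<otimes> b)" using C unfolding 2 by algebra
    finally have "a \<otimes> f = e \<otimes> b" using C by (simp add: m_lcancel)
    thus "(x, z) \<in> frac_rel R" using C by (simp add: x z frac_rel_def)
  qed
qed

lemma frac_eq_iff:
  assumes "a \<in> carrier R" "b \<in> carrier R - {\<zero>}" "c \<in> carrier R" "d \<in> carrier R - {\<zero>}"
  shows "frac_of R a b = frac_of R c d \<longleftrightarrow> a \<otimes> d = c \<otimes> b"
  unfolding frac_of_def using assms
  by (subst eq_equiv_class_iff[OF frac_rel_equiv]) (auto simp: frac_rel_def)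

lemma frac_closed:
  assumes "a \<in> carrier R" "b \<in> carrier R - {\<zero>}"
  shows "frac_of R a b \<in> carrier (frac_field R)"
  using assms by (auto simp: frac_field_def frac_of_def intro: quotientI)

lemma frac_cases:
  assumes "x \<in> carrier (frac_field R)"
  obtains a b where "a \<in> carrier R" "b \<in> carrier R" "b \<noteq> \<zero>" "x = frac_of R a b"
  using assms by (auto simp: frac_field_def frac_of_def elim!: quotientE)

lemma frac_mult:
  assumes "a \<in> carrier R" "b \<in> carrier R - {\<zero>}" "c \<in> carrier R" "d \<in> carrier R - {\<zero>}"
  shows "frac_of R a b \<otimes>\<^bsub>frac_field R\<^esub> frac_of R c d = frac_of R (a \<otimes> c) (b \<otimes> d)"
proof -
  have "congruent2 (frac_rel R) (frac_rel R) (\<lambda>p q. frac_of R (fst p \<otimes> fst q) (snd p \<otimes> snd q))"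
  proof (rule congruent2_commuteI[OF frac_rel_equiv], goal_cases)
    case (1 y z) thus ?case by (auto simp: m_comm)
  next
    case (2 y z w)
    obtain a b c d e f where yzw: "y = (a, b)" "z = (c, d)" "w = (e, f)"
      by (cases y, cases z, cases w)
    with 2 have e: "y = (a, b)" "z = (c, d)" "w = (e, f)"
      "a \<in> carrier R" "b \<in> carrier R" "c \<in> carrier R" "d \<in> carrier R"
      "e \<in> carrier R" "f \<in> carrier R" "b \<noteq> \<zero>" "d \<noteq> \<zero>" "f \<noteq> \<zero>" "a \<otimes> d = c \<otimes> b"
      by (auto simp: frac_rel_def)
    have "(e \<otimes> a) \<otimes> (f \<otimes> d) = (e \<otimes> f) \<otimes> (a \<otimes> d)" using e(4-9) by algebra
    also have "\<dots> = (e \<otimes> c) \<otimes> (f \<otimes> b)" using e(4-9) unfolding e(13) by algebra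
    finally show ?case using e by (simp add: frac_eq_iff integral_iff)
  qed
  from UN_equiv_class2[OF frac_rel_equiv frac_rel_equiv this, of "(a, b)" "(c, d)"] assms
  show ?thesis by (simp add: frac_field_def frac_of_def[of R a b] frac_of_def[of R c d])
qed

lemma frac_add:
  assumes "a \<in> carrier R" "b \<in> carrier R - {\<zero>}" "c \<in> carrier R" "d \<in> carrier R - {\<zero>}"
  shows "frac_of R a b \<oplus>\<^bsub>frac_field R\<^esub> frac_of R c d = frac_of R (a \<otimes> d \<oplus> c \<otimes> b) (b \<otimes> d)"
proof -
  have "congruent2 (frac_rel R) (frac_rel R)
          (\<lambda>p q. frac_of R (fst p \<otimes> snd q \<oplus> fst q \<otimes> snd p) (snd p \<otimes> snd q))"
  proof (rule congruent2_commuteI[OF frac_rel_equiv], goal_cases)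
    case (1 y z) thus ?case by (auto simp: m_comm a_comm)
  next
    case (2 y z w)
    obtain a b c d e f where yzw: "y = (a, b)" "z = (c, d)" "w = (e, f)"
      by (cases y, cases z, cases w)
    with 2 have e: "y = (a, b)" "z = (c, d)" "w = (e, f)"
      "a \<in> carrier R" "b \<in> carrier R" "c \<in> carrier R" "d \<in> carrier R"
      "e \<in> carrier R" "f \<in> carrier R" "b \<noteq> \<zero>" "d \<noteq> \<zero>" "f \<noteq> \<zero>" "a \<otimes> d = c \<otimes> b"
      by (auto simp: frac_rel_def)
    have "(e \<otimes> b \<oplus> a \<otimes> f) \<otimes> (f \<otimes> d) = e \<otimes> b \<otimes> f \<otimes> d \<oplus> (f \<otimes> f) \<otimes> (a \<otimes> d)"
      using e(4-9) by algebra
    also have "\<dots> = (e \<otimes> d \<oplus> c \<otimes> f) \<otimes> (f \<otimes> b)" using e(4-9) unfolding e(13) by algebra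
    finally show ?case using e by (simp add: frac_eq_iff integral_iff)
  qed
  from UN_equiv_class2[OF frac_rel_equiv frac_rel_equiv this, of "(a, b)" "(c, d)"] assms
  show ?thesis by (simp add: frac_field_def frac_of_def[of R a b] frac_of_def[of R c d])
qed

lemma frac_one: "\<one>\<^bsub>frac_field R\<^esub> = frac_of R \<one> \<one>"
  and frac_zero: "\<zero>\<^bsub>frac_field R\<^esub> = frac_of R \<zero> \<one>"
  by (simp_all add: frac_field_def)

lemma frac_field_field: "field (frac_field R)"
proof -
  note S = frac_one frac_zero frac_mult frac_add frac_eq_iff frac_closed integral_iff
  have cr: "cring (frac_field R)"
  proof (rule cringI)
    show "abelian_group (frac_field R)"
    proof (rule abelian_groupI, goal_cases)
      case (1 x y) thus ?case by (auto elim!: frac_cases simp: S)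
    next
      case 2 thus ?case by (simp add: S)
    next
      case (3 x y z)
      then obtain a b c d e f where e: "x = frac_of R a b" "y = frac_of R c d" "z = frac_of R e f"
        "a \<in> carrier R" "b \<in> carrier R" "c \<in> carrier R" "d \<in> carrier R"
        "e \<in> carrier R" "f \<in> carrier R" "b \<noteq> \<zero>" "d \<noteq> \<zero>" "f \<noteq> \<zero>"
        by (auto elim!: frac_cases)
      have "((a \<otimes> d \<oplus> c \<otimes> b) \<otimes> f \<oplus> e \<otimes> (b \<otimes> d)) \<otimes> (b \<otimes> (d \<otimes> f)) =
            (a \<otimes> (d \<otimes> f) \<oplus> (c \<otimes> f \<oplus> e \<otimes> d) \<otimes> b) \<otimes> (b \<otimes> d \<otimes> f)"
        using e(4-9) by algebra
      thus ?case using e by (simp add: S)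
    next
      case (4 x y)
      then obtain a b c d where e: "x = frac_of R a b" "y = frac_of R c d"
        "a \<in> carrier R" "b \<in> carrier R" "c \<in> carrier R" "d \<in> carrier R" "b \<noteq> \<zero>" "d \<noteq> \<zero>"
        by (auto elim!: frac_cases)
      thus ?case by (simp add: S m_comm a_comm)
    next
      case (5 x) thus ?case by (auto elim!: frac_cases simp: S)
    next
      case (6 x)
      then obtain a b where e: "x = frac_of R a b" "a \<in> carrier R" "b \<in> carrier R" "b \<noteq> \<zero>"
        by (auto elim!: frac_cases)
      have "(\<ominus> a \<otimes> b \<oplus> a \<otimes> b) \<otimes> \<one> = \<zero> \<otimes> (b \<otimes> b)" using e(2,3) by algebra
      hence "frac_of R (\<ominus> a) b \<oplus>\<^bsub>frac_field R\<^esub> x = \<zero>\<^bsub>frac_field R\<^esub>"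
        using e by (simp add: S)
      thus ?case using e by (intro bexI[of _ "frac_of R (\<ominus> a) b"]) (auto simp: S)
    qed
    show "Group.comm_monoid (frac_field R)"
      by (rule comm_monoidI) (auto elim!: frac_cases simp: S m_ac)
  next
    fix x y z
    assume "x \<in> carrier (frac_field R)" "y \<in> carrier (frac_field R)" "z \<in> carrier (frac_field R)"
    then obtain a b c d e f where e: "x = frac_of R a b" "y = frac_of R c d" "z = frac_of R e f"
      "a \<in> carrier R" "b \<in> carrier R" "c \<in> carrier R" "d \<in> carrier R"
      "e \<in> carrier R" "f \<in> carrier R" "b \<noteq> \<zero>" "d \<noteq> \<zero>" "f \<noteq> \<zero>"
      by (auto elim!: frac_cases)
    have "((a \<otimes> d \<oplus> c \<otimes> b) \<otimes> e) \<otimes> ((b \<otimes> f) \<otimes> (d \<otimes> f)) =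
          (a \<otimes> e \<otimes> (d \<otimes> f) \<oplus> c \<otimes> e \<otimes> (b \<otimes> f)) \<otimes> ((b \<otimes> d) \<otimes> f)"
      using e(4-9) by algebra
    thus "(x \<oplus>\<^bsub>frac_field R\<^esub> y) \<otimes>\<^bsub>frac_field R\<^esub> z =
          (x \<otimes>\<^bsub>frac_field R\<^esub> z) \<oplus>\<^bsub>frac_field R\<^esub> (y \<otimes>\<^bsub>frac_field R\<^esub> z)"
      using e by (simp add: S)
  qed
  show ?thesis
  proof (rule cring.cring_fieldI2[OF cr])
    show "\<zero>\<^bsub>frac_field R\<^esub> \<noteq> \<one>\<^bsub>frac_field R\<^esub>" by (simp add: S)
  next
    fix x assume x: "x \<in> carrier (frac_field R)" "x \<noteq> \<zero>\<^bsub>frac_field R\<^esub>"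
    then obtain a b where e: "x = frac_of R a b" "a \<in> carrier R" "b \<in> carrier R" "b \<noteq> \<zero>"
      by (auto elim!: frac_cases)
    hence "a \<noteq> \<zero>" using x by (auto simp: S)
    thus "\<exists>y\<in>carrier (frac_field R). x \<otimes>\<^bsub>frac_field R\<^esub> y = \<one>\<^bsub>frac_field R\<^esub>"
      using e by (intro bexI[of _ "frac_of R b a"]) (auto simp: S m_comm)
  qed
qed

lemma to_frac_hom: "to_frac R \<in> ring_hom R (frac_field R)"
  by (rule ring_hom_memI)
    (simp_all add: to_frac_def frac_closed frac_mult frac_add frac_one)

lemma to_frac_inj: "inj_on (to_frac R) (carrier R)"
  by (rule inj_onI) (simp add: to_frac_def frac_eq_iff)

end


section \<open>Dedekind domains\<close>

definition integral_over :: "('a, 'b) ring_scheme \<Rightarrow> 'a set \<Rightarrow> 'a \<Rightarrow> bool" where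
  "integral_over K S x \<longleftrightarrow>
     (\<exists>p \<in> carrier (S [X]\<^bsub>K\<^esub>). p \<noteq> [] \<and> lead_coeff p = \<one>\<^bsub>K\<^esub> \<and> ring.eval K p x = \<zero>\<^bsub>K\<^esub>)"

definition integrally_closed :: "('a, 'b) ring_scheme \<Rightarrow> bool" where
  "integrally_closed R \<longleftrightarrow>
     (\<forall>x \<in> carrier (frac_field R).
        integral_over (frac_field R) (to_frac R ` carrier R) x \<longrightarrow> x \<in> to_frac R ` carrier R)"

text \<open>Fields are counted as Dedekind domains.\<close>

locale dedekind_domain = noetherian_domain R for R (structure) +
  assumes integrally_closed: "integrally_closed R"
    and prime_maximal: "\<lbrakk> primeideal P R; P \<noteq> {\<zero>} \<rbrakk> \<Longrightarrow> maximalideal P R"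


section \<open>PRINC domains\<close>

definition idempotent_pair :: "('a, 'b) ring_scheme \<Rightarrow> 'a \<Rightarrow> 'a \<Rightarrow> bool" where
  "idempotent_pair R a b \<longleftrightarrow> a \<in> carrier R \<and> b \<in> carrier R \<and>
     (a \<otimes>\<^bsub>R\<^esub> (\<one>\<^bsub>R\<^esub> \<ominus>\<^bsub>R\<^esub> a) \<in> PIdl\<^bsub>R\<^esub> b \<or> b \<otimes>\<^bsub>R\<^esub> (\<one>\<^bsub>R\<^esub> \<ominus>\<^bsub>R\<^esub> b) \<in> PIdl\<^bsub>R\<^esub> a)"

locale princ_domain = domain R for R (structure) +
  assumes princ: "idempotent_pair R a b \<Longrightarrow> principalideal (Idl {a, b}) R"

end

theory Submission
  imports Defs
begin

text \<open>A Noetherian ring whose prime ideals are principal is a principal ideal ring (a maximal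
  nonprincipal ideal would be prime), so it suffices to treat a nonzero prime \<open>P\<close> of a Dedekind
  PRINC domain. For \<open>0 \<noteq> c \<in> P\<close> there is \<open>x \<notin> cR\<close> with \<open>xP \<subseteq> cR\<close>. By integral closedness
  \<open>(x/c)P\<close> is not contained in \<open>P\<close>, so \<open>xp = sc\<close> with \<open>p \<in> P\<close> and \<open>s \<notin> P\<close>, whence \<open>sP \<subseteq> pR\<close>.
  Since \<open>P\<close> is maximal, \<open>1 = a + ts\<close> with \<open>a \<in> P\<close>. Then \<open>a(1 - a) \<in> pR\<close>, and \<open>P = aP + tsP\<close> is
  generated by the idempotent pair \<open>a, p\<close>.\<close>

section \<open>Two forms of the ascending chain condition\<close>

text \<open>In a Noetherian ring a nonempty chain of ideals contains its union, so the upper bound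
  that Zorn's lemma asks for already lies in \<open>\<F>\<close>.\<close>

lemma (in noetherian_ring) ex_maximal_ideal_in:
  assumes "\<F> \<noteq> {}" "\<And>I. I \<in> \<F> \<Longrightarrow> ideal I R"
  obtains M where "M \<in> \<F>" "\<And>I. I \<in> \<F> \<Longrightarrow> M \<subseteq> I \<Longrightarrow> I = M"
proof -
  have "\<exists>M\<in>\<F>. \<forall>I\<in>\<F>. M \<subseteq> I \<longrightarrow> I = M"
  proof (rule subset_Zorn_nonempty[OF assms(1)])
    fix C assume C: "C \<noteq> {}" "subset.chain \<F> C"
    moreover have "subset.chain {I. ideal I R} C"
      using C assms(2) by (auto simp: subset_chain_def)
    ultimately have "\<Union>C \<in> C" by (intro ideal_chain_is_trivial)
    thus "\<Union>C \<in> \<F>" using C by (auto simp: subset_chain_def)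
  qed
  thus ?thesis using that by blast
qed

text \<open>The ideals generated by the first \<open>n\<close> terms form a chain, so one of them
  contains all the others, in particular the next term. This will supply the monic equation in the
  integrality argument.\<close>

lemma (in noetherian_ring) ex_mem_genideal_previous:
  fixes p :: "nat \<Rightarrow> 'a"
  assumes "range p \<subseteq> carrier R"
  shows "\<exists>n. p n \<in> Idl (p ` {..<n})"
proof -
  let ?I = "\<lambda>n. Idl (p ` {..<n})"
  have carr: "p ` {..<n} \<subseteq> carrier R" for n using assms by auto
  have mono: "?I m \<subseteq> ?I n" if "m \<le> n" for m n
    using that carr by (intro subset_Idl_subset image_mono) auto
  have lin: "?I m \<subseteq> ?I n \<or> ?I n \<subseteq> ?I m" for m n
    using mono nat_le_linear by metis
  have "subset.chain {I. ideal I R} (range ?I)"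
    unfolding subset_chain_def using genideal_ideal[OF carr] lin by blast
  then have "\<Union>(range ?I) \<in> range ?I"
    by (intro ideal_chain_is_trivial) auto
  then obtain n where n: "\<Union>(range ?I) = ?I n" by auto
  have "p n \<in> ?I (Suc n)" using genideal_self[OF carr[of "Suc n"]] by auto
  hence "p n \<in> ?I n" using n by blast
  thus ?thesis by blast
qed

section \<open>Reduction to prime ideals\<close>

text \<open>The colon ideal (I : x) serves twice: with \<open>I\<close> maximal among nonprincipal
  ideals, and with I = cR inside a prime.\<close>

lemma (in cring) colon_ideal:
  assumes "ideal I R" "x \<in> carrier R"
  shows "ideal {r \<in> carrier R. r \<otimes> x \<in> I} R"
proof -
  interpret ideal I R by fact
  show ?thesis
  proof (rule idealI[OF ring_axioms])
    show "subgroup {r \<in> carrier R. r \<otimes> x \<in> I} (add_monoid R)"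
    proof (rule add.subgroupI)
      have "\<zero> \<in> {r \<in> carrier R. r \<otimes> x \<in> I}" using assms(2) by simp
      thus "{r \<in> carrier R. r \<otimes> x \<in> I} \<noteq> {}" by blast
    qed (use assms(2) in \<open>auto simp: l_minus l_distr\<close>)
  next
    fix a r assume a: "a \<in> {r \<in> carrier R. r \<otimes> x \<in> I}" and r: "r \<in> carrier R"
    have "r \<otimes> (a \<otimes> x) \<in> I" using a r I_l_closed by blast
    moreover have "r \<otimes> a \<otimes> x = r \<otimes> (a \<otimes> x)" "a \<otimes> r \<otimes> x = r \<otimes> (a \<otimes> x)"
      using a r assms(2) by (auto simp: m_assoc m_lcomm)
    ultimately show "r \<otimes> a \<in> {r \<in> carrier R. r \<otimes> x \<in> I}" "a \<otimes> r \<in> {r \<in> carrier R. r \<otimes> x \<in> I}"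
      using a r by auto
  qed
qed

lemma (in cring) add_PIdl:
  assumes "ideal I R" "u \<in> carrier R"
  shows "ideal (I <+>\<^bsub>R\<^esub> PIdl u) R" "I \<subseteq> I <+>\<^bsub>R\<^esub> PIdl u" "u \<in> I <+>\<^bsub>R\<^esub> PIdl u"
proof -
  interpret I: ideal I R by fact
  interpret U: ideal "PIdl u" R by (rule cgenideal_ideal) fact
  show "ideal (I <+>\<^bsub>R\<^esub> PIdl u) R" by (intro add_ideals assms cgenideal_ideal)
  show "I \<subseteq> I <+>\<^bsub>R\<^esub> PIdl u"
  proof
    fix i assume "i \<in> I"
    then have "i = i \<oplus> \<zero>" "i \<in> I" by auto
    then show "i \<in> I <+>\<^bsub>R\<^esub> PIdl u" using U.zero_closed unfolding set_add_def' by blast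
  qed
  have "u = \<zero> \<oplus> u" "u \<in> PIdl u" using assms(2) by (auto intro: cgenideal_self)
  then show "u \<in> I <+>\<^bsub>R\<^esub> PIdl u" using I.zero_closed unfolding set_add_def' by blast
qed

text \<open>If neither \<open>u\<close> nor \<open>v\<close> lay in \<open>I\<close>, both I + uR
  and (I : u) would strictly contain \<open>I\<close> and so have generators \<open>d\<close> and
  \<open>e\<close>; then ed would generate \<open>I\<close>.\<close>

lemma (in cring) maximal_nonprincipal_prime:
  assumes I: "ideal I R" and np: "\<not> (\<exists>a\<in>carrier R. I = PIdl a)"
    and max: "\<And>J. ideal J R \<Longrightarrow> I \<subset> J \<Longrightarrow> \<exists>a\<in>carrier R. J = PIdl a"
  shows "primeideal I R"
proof (rule primeidealI[OF I is_cring])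
  interpret I: ideal I R by fact
  show "carrier R \<noteq> I"
    using np genideal_one cgenideal_eq_genideal[of \<one>] by auto
  fix u v assume uv: "u \<in> carrier R" "v \<in> carrier R" "u \<otimes> v \<in> I"
  show "u \<in> I \<or> v \<in> I"
  proof (rule ccontr)
    assume not: "\<not> (u \<in> I \<or> v \<in> I)"
    let ?J = "I <+>\<^bsub>R\<^esub> PIdl u" and ?Q = "{r \<in> carrier R. r \<otimes> u \<in> I}"
    have IJ: "I \<subset> ?J" using add_PIdl[OF I uv(1)] not by blast
    then obtain d where d: "d \<in> carrier R" "?J = PIdl d"
      using max[OF add_PIdl(1)[OF I uv(1)] IJ] by blast
    have "I \<subseteq> ?Q" using uv by (auto intro: I.I_r_closed)
    moreover have "v \<in> ?Q" using uv by (simp add: m_comm)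
    ultimately have IQ: "I \<subset> ?Q" using not by blast
    then obtain e where e: "e \<in> carrier R" "?Q = PIdl e"
      using max[OF colon_ideal[OF I uv(1)] IQ] by blast
    have "e \<in> ?Q" unfolding e(2) using e(1) by (rule cgenideal_self)
    then have eu: "e \<otimes> u \<in> I" by simp
    have "d \<in> ?J" unfolding d(2) using d(1) by (rule cgenideal_self)
    then obtain i t where it: "i \<in> I" "t \<in> carrier R" "d = i \<oplus> t \<otimes> u"
      by (auto simp: set_add_def' cgenideal_def)
    \<comment> \<open>Modulo \<open>I\<close>, \<open>d\<close> is a multiple of \<open>u\<close>,
      and \<open>e\<close> multiplies \<open>u\<close> into \<open>I\<close>.\<close>
    have "e \<otimes> d = e \<otimes> i \<oplus> t \<otimes> (e \<otimes> u)"
      unfolding it(3) using it(1,2) uv(1) e(1) by (simp add: r_distr m_lcomm)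
    then have ed: "e \<otimes> d \<in> I" using it(1,2) e(1) eu by (simp add: I.I_l_closed)
    have "I = PIdl (e \<otimes> d)"
    proof
      show "PIdl (e \<otimes> d) \<subseteq> I" by (rule cgenideal_minimal[OF I ed])
      show "I \<subseteq> PIdl (e \<otimes> d)"
      proof
        fix j assume j: "j \<in> I"
        have "j \<in> PIdl d" using subsetD[OF add_PIdl(2)[OF I uv(1)] j] unfolding d(2) .
        then obtain w where w: "w \<in> carrier R" "j = w \<otimes> d"
          by (auto simp: cgenideal_def)
        have "u \<in> PIdl d" using add_PIdl(3)[OF I uv(1)] unfolding d(2) .
        then obtain z where z: "z \<in> carrier R" "u = z \<otimes> d"
          by (auto simp: cgenideal_def)
        \<comment> \<open>The right-hand side lies in \<open>I\<close>, which puts \<open>w\<close>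
          into (I : u) = eR; this factor \<open>e\<close> makes j = wd a multiple of ed.\<close>
        have "w \<otimes> u = z \<otimes> j" unfolding z(2) w(2) using w(1) z(1) d(1) by (rule m_lcomm)
        then have "w \<in> ?Q" using w(1) I.I_l_closed[OF j z(1)] by simp
        then obtain k where k: "k \<in> carrier R" "w = k \<otimes> e"
          unfolding e(2) by (auto simp: cgenideal_def)
        have "j = k \<otimes> (e \<otimes> d)" unfolding w(2) k(2) using k(1) e(1) d(1) by (rule m_assoc)
        then show "j \<in> PIdl (e \<otimes> d)" using k unfolding cgenideal_def by blast
      qed
    qed
    then show False using np m_closed[OF e(1) d(1)] by blast
  qed
qed

lemma (in noetherian_domain) principal_domain_if_primes_principal:
  assumes "\<And>P. primeideal P R \<Longrightarrow> \<exists>a\<in>carrier R. P = PIdl a"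
  shows "principal_domain R"
proof unfold_locales
  fix I assume I: "ideal I R"
  show "\<exists>a\<in>carrier R. I = PIdl a"
  proof (rule ccontr)
    assume "\<not> ?thesis"
    then have ne: "{I. ideal I R \<and> \<not> (\<exists>a\<in>carrier R. I = PIdl a)} \<noteq> {}" using I by blast
    obtain M where M: "ideal M R" "\<not> (\<exists>a\<in>carrier R. M = PIdl a)"
      and "\<And>J. ideal J R \<Longrightarrow> M \<subset> J \<Longrightarrow> \<exists>a\<in>carrier R. J = PIdl a"
      using ex_maximal_ideal_in[OF ne] by (smt (verit, best) mem_Collect_eq psubset_eq)
    then have "primeideal M R" by (intro maximal_nonprincipal_prime)
    then show False using assms M by blast
  qed
qed

section \<open>Integrality of a fraction that maps a set into itself\<close>

lemma (in domain) frac_mult_to_frac: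
  assumes "x \<in> carrier R" "c \<in> carrier R - {\<zero>}" "q \<in> carrier R" "r \<in> carrier R"
    and "x \<otimes> q = r \<otimes> c"
  shows "to_frac R r = frac_of R x c \<otimes>\<^bsub>frac_field R\<^esub> to_frac R q"
  using assms by (simp add: to_frac_def frac_mult frac_eq_iff)

text \<open>Put y = x/c. Every y^n p_0 stays in \<open>P\<close>, and by the chain condition some
  y^n p_0 is an R-combination of the y^i p_0 with i < n. Cancelling p_0 in the fraction field leaves
  a monic equation for y. This replaces the usual determinant argument.\<close>

lemma (in noetherian_domain) integral_over_if_mult_stable:
  assumes x: "x \<in> carrier R" and c: "c \<in> carrier R - {\<zero>}"
    and P: "P \<subseteq> carrier R" "p\<^sub>0 \<in> P" "p\<^sub>0 \<noteq> \<zero>"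
    and stable: "\<And>q. q \<in> P \<Longrightarrow> \<exists>r\<in>P. x \<otimes> q = r \<otimes> c"
  shows "integral_over (frac_field R) (to_frac R ` carrier R) (frac_of R x c)"
proof -
  let ?K = "frac_field R" and ?\<phi> = "to_frac R" and ?y = "frac_of R x c"
  interpret K: field ?K by (rule frac_field_field)
  interpret \<phi>: ring_hom_ring R ?K ?\<phi>
    by (intro ring_hom_ringI2 ring_axioms K.ring_axioms to_frac_hom)
  have y: "?y \<in> carrier ?K" using x c by (rule frac_closed)
  obtain f where f: "\<And>q. q \<in> P \<Longrightarrow> f q \<in> P" "\<And>q. q \<in> P \<Longrightarrow> x \<otimes> q = f q \<otimes> c"
    using stable by metis
  \<comment> \<open>On \<open>P\<close> the map \<open>f\<close> is multiplication by y, so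
    \<open>p n\<close> is y^n p_0 kept as an element of \<open>R\<close>.\<close>
  define p where "p n = (f ^^ n) p\<^sub>0" for n
  have pS: "p (Suc n) = f (p n)" for n by (simp add: p_def)
  have pP: "p n \<in> P" for n by (induction n) (use P f in \<open>auto simp: p_def\<close>)
  have pR: "p n \<in> carrier R" for n using pP P by blast
  have p0: "p\<^sub>0 \<in> carrier R" using P by blast
  have \<phi>p: "?\<phi> (p n) = ?y [^]\<^bsub>?K\<^esub> n \<otimes>\<^bsub>?K\<^esub> ?\<phi> p\<^sub>0" for n
  proof (induction n)
    case 0 thus ?case using p0 by (simp add: p_def)
  next
    case (Suc n)
    have "?\<phi> (p (Suc n)) = ?y \<otimes>\<^bsub>?K\<^esub> ?\<phi> (p n)"
      using frac_mult_to_frac[OF x c pR[of n] pR[of "Suc n"]] f(2)[OF pP[of n]] by (simp add: pS)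
    thus ?case using Suc y p0 by (simp add: K.m_ac)
  qed
  \<comment> \<open>\<open>l\<close> lists the negated coefficients of \<open>z\<close> as a
    combination of the first \<open>n\<close> terms of \<open>p\<close>, highest first and possibly
    with leading zeros. Its length is exactly \<open>n\<close>, so that the head of
    \<open>\<one> # l\<close> becomes the coefficient of y^n.\<close>
  have rep: "\<exists>l. length l = n \<and> set l \<subseteq> ?\<phi> ` carrier R \<and>
      ?\<phi> z \<oplus>\<^bsub>?K\<^esub> K.eval l ?y \<otimes>\<^bsub>?K\<^esub> ?\<phi> p\<^sub>0 = \<zero>\<^bsub>?K\<^esub>"
    if "z \<in> Idl (p ` {..<n})" for z n using that
  proof (induction n arbitrary: z)
    case 0
    then have "z = \<zero>" using genideal_minimal[OF zeroideal] by auto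
    then show ?case using p0 by simp
  next
    case (Suc n)
    have carr: "p ` {..<n} \<subseteq> carrier R" using pR by auto
    note id = genideal_ideal[OF carr]
    have "Idl (p ` {..<Suc n}) \<subseteq> Idl (p ` {..<n}) <+>\<^bsub>R\<^esub> PIdl (p n)"
      using add_PIdl[OF id pR[of n]] genideal_self[OF carr]
      by (intro genideal_minimal) (auto simp: lessThan_Suc)
    then have "z \<in> Idl (p ` {..<n}) <+>\<^bsub>R\<^esub> PIdl (p n)" using Suc.prems by (rule subsetD)
    then obtain z' r where z: "z' \<in> Idl (p ` {..<n})" "r \<in> carrier R" "z = z' \<oplus> r \<otimes> p n"
      by (auto simp: set_add_def' cgenideal_def)
    have z': "z' \<in> carrier R" using z ideal.Icarr[OF id] by blast
    from Suc.IH[OF z(1)] obtain l where l: "length l = n" "set l \<subseteq> ?\<phi> ` carrier R"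
      "?\<phi> z' \<oplus>\<^bsub>?K\<^esub> K.eval l ?y \<otimes>\<^bsub>?K\<^esub> ?\<phi> p\<^sub>0 = \<zero>\<^bsub>?K\<^esub>" by blast
    have ev: "K.eval l ?y \<in> carrier ?K" using l(2) y by (intro K.eval_in_carrier) auto
    have yn: "?y [^]\<^bsub>?K\<^esub> n \<in> carrier ?K" using y by simp
    have C: "?\<phi> z' \<in> carrier ?K" "?\<phi> r \<in> carrier ?K" "?\<phi> p\<^sub>0 \<in> carrier ?K"
      using z z' p0 by auto
    \<comment> \<open>The new head -r, the coefficient of y^n, cancels the term r p_n of
      \<open>z\<close>.\<close>
    have "?\<phi> z \<oplus>\<^bsub>?K\<^esub> K.eval (?\<phi> (\<ominus> r) # l) ?y \<otimes>\<^bsub>?K\<^esub> ?\<phi> p\<^sub>0 =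
       (?\<phi> z' \<oplus>\<^bsub>?K\<^esub> ?\<phi> r \<otimes>\<^bsub>?K\<^esub> (?y [^]\<^bsub>?K\<^esub> n \<otimes>\<^bsub>?K\<^esub> ?\<phi> p\<^sub>0)) \<oplus>\<^bsub>?K\<^esub>
       (\<ominus>\<^bsub>?K\<^esub> ?\<phi> r \<otimes>\<^bsub>?K\<^esub> ?y [^]\<^bsub>?K\<^esub> n \<oplus>\<^bsub>?K\<^esub> K.eval l ?y) \<otimes>\<^bsub>?K\<^esub> ?\<phi> p\<^sub>0"
      using z z' l(1) pR \<phi>p by simp
    also have "\<dots> = ?\<phi> z' \<oplus>\<^bsub>?K\<^esub> K.eval l ?y \<otimes>\<^bsub>?K\<^esub> ?\<phi> p\<^sub>0"
      using C ev yn by algebra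
    finally have "?\<phi> z \<oplus>\<^bsub>?K\<^esub> K.eval (?\<phi> (\<ominus> r) # l) ?y \<otimes>\<^bsub>?K\<^esub> ?\<phi> p\<^sub>0 = \<zero>\<^bsub>?K\<^esub>"
      using l(3) by simp
    moreover have "length (?\<phi> (\<ominus> r) # l) = Suc n" "set (?\<phi> (\<ominus> r) # l) \<subseteq> ?\<phi> ` carrier R"
      using l z by (auto simp del: \<phi>.hom_a_inv)
    ultimately show ?case by blast
  qed
  obtain n where "p n \<in> Idl (p ` {..<n})"
    using ex_mem_genideal_previous[of p] pR by blast
  from rep[OF this] obtain l where l: "length l = n" "set l \<subseteq> ?\<phi> ` carrier R"
    "?\<phi> (p n) \<oplus>\<^bsub>?K\<^esub> K.eval l ?y \<otimes>\<^bsub>?K\<^esub> ?\<phi> p\<^sub>0 = \<zero>\<^bsub>?K\<^esub>" by blast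
  have ev: "K.eval l ?y \<in> carrier ?K" using l(2) y by (intro K.eval_in_carrier) auto
  have \<phi>0: "?\<phi> p\<^sub>0 \<in> carrier ?K" using p0 by simp
  have "(?y [^]\<^bsub>?K\<^esub> n \<oplus>\<^bsub>?K\<^esub> K.eval l ?y) \<otimes>\<^bsub>?K\<^esub> ?\<phi> p\<^sub>0 = \<zero>\<^bsub>?K\<^esub>"
    using l(3) ev y \<phi>0 by (simp add: \<phi>p K.l_distr)
  moreover have "?\<phi> p\<^sub>0 \<noteq> \<zero>\<^bsub>?K\<^esub>"
    using to_frac_inj P p0 \<phi>.hom_zero by (metis inj_onD zero_closed)
  ultimately have root: "?y [^]\<^bsub>?K\<^esub> n \<oplus>\<^bsub>?K\<^esub> K.eval l ?y = \<zero>\<^bsub>?K\<^esub>"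
    using K.integral ev y \<phi>0 by (metis K.add.m_closed K.nat_pow_closed)
  show ?thesis unfolding integral_over_def
  proof (intro bexI conjI)
    have "\<one>\<^bsub>?K\<^esub> \<in> ?\<phi> ` carrier R" using \<phi>.hom_one one_closed by (metis imageI)
    then show "\<one>\<^bsub>?K\<^esub> # l \<in> carrier ((?\<phi> ` carrier R) [X]\<^bsub>?K\<^esub>)"
      using l(2) by (simp add: univ_poly_def polynomial_def)
    show "K.eval (\<one>\<^bsub>?K\<^esub> # l) ?y = \<zero>\<^bsub>?K\<^esub>" using root y l(1) by simp
  qed auto
qed

section \<open>Colon ideals and local generators of a nonzero prime\<close>

text \<open>An ideal \<open>(cR : x)\<close> that is maximal among those contained in \<open>P\<close> is prime.\<close>

lemma (in noetherian_domain) ex_colon_eq_prime: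
  assumes "primeideal P R" "c \<in> P" "c \<noteq> \<zero>"
    and min: "\<And>Q. primeideal Q R \<Longrightarrow> Q \<noteq> {\<zero>} \<Longrightarrow> Q \<subseteq> P \<Longrightarrow> Q = P"
  obtains x where "x \<in> carrier R" "P = {r \<in> carrier R. r \<otimes> x \<in> PIdl c}"
proof -
  interpret P: primeideal P R by fact
  let ?Q = "\<lambda>x. {r \<in> carrier R. r \<otimes> x \<in> PIdl c}"
  have c: "c \<in> carrier R" using assms(2) by simp
  interpret C: ideal "PIdl c" R using c by (rule cgenideal_ideal)
  have id: "ideal (?Q x) R" if "x \<in> carrier R" for x
    using that c by (intro colon_ideal cgenideal_ideal)
  let ?F = "{?Q x | x. x \<in> carrier R \<and> ?Q x \<subseteq> P}"
  have "PIdl c \<subseteq> P" using P.is_ideal assms(2) by (rule cgenideal_minimal)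
  then have "?Q \<one> \<subseteq> P" by auto
  then have ne: "?F \<noteq> {}" by blast
  obtain M where "M \<in> ?F" and M: "\<And>I. I \<in> ?F \<Longrightarrow> M \<subseteq> I \<Longrightarrow> I = M"
    using ex_maximal_ideal_in[OF ne] id by blast
  then obtain x where x: "x \<in> carrier R" "?Q x \<subseteq> P" "M = ?Q x" by blast
  \<comment> \<open>Passing from \<open>x\<close> to a multiple wx can only enlarge the colon ideal,
    so maximality of \<open>M\<close> forces equality as long as it stays inside
    \<open>P\<close>.\<close>
  have max: "?Q (w \<otimes> x) = ?Q x" if "w \<in> carrier R" "?Q (w \<otimes> x) \<subseteq> P" for w
  proof -
    have "?Q x \<subseteq> ?Q (w \<otimes> x)"
    proof safe
      fix r assume r: "r \<in> carrier R" "r \<otimes> x \<in> PIdl c"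
      have "w \<otimes> (r \<otimes> x) \<in> PIdl c" using r(2) that(1) by (rule C.I_l_closed)
      then show "r \<otimes> (w \<otimes> x) \<in> PIdl c" using r x that by (simp add: m_lcomm)
    qed
    then show ?thesis using M[of "?Q (w \<otimes> x)"] x that by blast
  qed
  have "primeideal (?Q x) R"
  proof (rule primeidealI[OF id[OF x(1)] is_cring])
    show "carrier R \<noteq> ?Q x" using x P.I_notcarr P.a_subset by auto
    fix u v assume uv: "u \<in> carrier R" "v \<in> carrier R" "u \<otimes> v \<in> ?Q x"
    show "u \<in> ?Q x \<or> v \<in> ?Q x"
    \<comment> \<open>If (cR : ux) lies in \<open>P\<close>, it equals (cR : x) and contains
      \<open>v\<close>. Otherwise some \<open>t\<close> outside \<open>P\<close> has tux in cR; then
      (cR : tx) lies in \<open>P\<close>, because wt in \<open>P\<close> forces \<open>w\<close> in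
      \<open>P\<close>, so it equals (cR : x), and it contains \<open>u\<close>.\<close>
    proof (cases "?Q (u \<otimes> x) \<subseteq> P")
      case True
      have "v \<in> ?Q (u \<otimes> x)" using uv x by (simp add: m_ac)
      then show ?thesis using max[OF uv(1) True] by simp
    next
      case False
      then obtain t where t: "t \<in> carrier R" "t \<otimes> (u \<otimes> x) \<in> PIdl c" "t \<notin> P" by blast
      have "?Q (t \<otimes> x) \<subseteq> P"
      proof safe
        fix w assume w: "w \<in> carrier R" "w \<otimes> (t \<otimes> x) \<in> PIdl c"
        then have "w \<otimes> t \<in> ?Q x" using t x by (simp add: m_assoc)
        then show "w \<in> P" using x(2) P.I_prime[OF w(1) t(1)] t(3) by blast
      qed
      moreover have "u \<in> ?Q (t \<otimes> x)" using t uv x by (simp add: m_lcomm)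
      ultimately show ?thesis using max[OF t(1)] by blast
    qed
  qed
  moreover have "c \<in> ?Q x" using c x by (simp add: C.I_r_closed cgenideal_self)
  then have "?Q x \<noteq> {\<zero>}" using assms(3) by blast
  ultimately have "?Q x = P" using min x(2) by blast
  then show ?thesis using that x(1) by blast
qed

text \<open>In the localization at \<open>P\<close> the element \<open>s\<close> becomes a unit, so
  the last conclusion says that \<open>p\<close> generates \<open>P\<close> there; this form avoids
  constructing the localization.\<close>

lemma (in dedekind_domain) prime_locally_principal:
  assumes "primeideal P R" "P \<noteq> {\<zero>}"
  obtains p s where "p \<in> P" "s \<in> carrier R" "s \<notin> P" "\<And>q. q \<in> P \<Longrightarrow> s \<otimes> q \<in> PIdl p"
proof -
  interpret P: primeideal P R by fact
  obtain c where c: "c \<in> P" "c \<noteq> \<zero>" using assms(2) P.zero_closed by blast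
  then have cR: "c \<in> carrier R - {\<zero>}" by simp
  have "Q = P" if "primeideal Q R" "Q \<noteq> {\<zero>}" "Q \<subseteq> P" for Q
  proof -
    interpret Q: maximalideal Q R using that by (intro prime_maximal)
    show ?thesis using Q.I_maximal[OF P.is_ideal that(3)] P.a_subset P.I_notcarr by auto
  qed
  then obtain x where x: "x \<in> carrier R" and Px: "P = {r \<in> carrier R. r \<otimes> x \<in> PIdl c}"
    using ex_colon_eq_prime[OF assms(1) c] by blast
  have xP: "\<exists>r\<in>carrier R. x \<otimes> q = r \<otimes> c" if "q \<in> P" for q
    using that x unfolding Px cgenideal_def by (auto simp: m_comm)
  \<comment> \<open>Otherwise x/c would be integral over \<open>R\<close>, hence in
    \<open>R\<close>. Then \<open>x\<close> would lie in cR, and P = (cR : x) would contain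
    one.\<close>
  have "\<exists>q\<in>P. \<forall>r\<in>P. x \<otimes> q \<noteq> r \<otimes> c"
  proof (rule ccontr)
    assume "\<not> ?thesis"
    then have "integral_over (frac_field R) (to_frac R ` carrier R) (frac_of R x c)"
      using P.a_subset c by (intro integral_over_if_mult_stable[OF x cR]) auto
    then have "frac_of R x c \<in> to_frac R ` carrier R"
      using integrally_closed frac_closed[OF x cR] unfolding integrally_closed_def by blast
    then obtain r where r: "r \<in> carrier R" "frac_of R x c = to_frac R r" by blast
    then have "x = r \<otimes> c" using x cR by (simp add: to_frac_def frac_eq_iff)
    then have "\<one> \<in> P" using x r unfolding Px cgenideal_def by auto
    then show False using P.one_imp_carrier P.I_notcarr by blast
  qed
  then obtain p where p: "p \<in> P" "\<And>r. r \<in> P \<Longrightarrow> x \<otimes> p \<noteq> r \<otimes> c" by blast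
  \<comment> \<open>The choice of \<open>p\<close> rules out \<open>s\<close> in
    \<open>P\<close>.\<close>
  obtain s where s: "s \<in> carrier R" "x \<otimes> p = s \<otimes> c" using xP[OF p(1)] by blast
  have "s \<otimes> q \<in> PIdl p" if q: "q \<in> P" for q
  proof -
    obtain r where r: "r \<in> carrier R" "x \<otimes> q = r \<otimes> c" using xP[OF q] by blast
    \<comment> \<open>Comparing xq = rc with xp = sc through the product xpq and cancelling
      \<open>c\<close> gives sq = rp.\<close>
    have C: "p \<in> carrier R" "q \<in> carrier R" "c \<in> carrier R" using p q c by auto
    have "c \<otimes> (s \<otimes> q) = (s \<otimes> c) \<otimes> q" using C s(1) by algebra
    also have "\<dots> = (x \<otimes> q) \<otimes> p" using C x unfolding s(2)[symmetric] by algebra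
    also have "\<dots> = c \<otimes> (r \<otimes> p)" using C r(1) unfolding r(2) by algebra
    finally have "s \<otimes> q = r \<otimes> p" using C c s(1) r(1) by (simp add: m_lcancel)
    then show ?thesis using r(1) unfolding cgenideal_def by blast
  qed
  then show ?thesis using that p s by blast
qed

section \<open>Nonzero primes from idempotent pairs\<close>

lemma (in dedekind_domain) prime_idempotent_pair:
  assumes "primeideal P R" "P \<noteq> {\<zero>}"
  obtains a b where "idempotent_pair R a b" "P = Idl {a, b}"
proof -
  interpret P: primeideal P R by fact
  interpret M: maximalideal P R using assms by (rule prime_maximal)
  obtain p s where p: "p \<in> P" and s: "s \<in> carrier R" "s \<notin> P"
    and sP: "\<And>q. q \<in> P \<Longrightarrow> s \<otimes> q \<in> PIdl p"
    using prime_locally_principal[OF assms] by blast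
  have pR: "p \<in> carrier R" using p by simp
  interpret p: ideal "PIdl p" R using pR by (rule cgenideal_ideal)
  note sum = add_PIdl[OF P.is_ideal s(1)]
  have "P <+>\<^bsub>R\<^esub> PIdl s = carrier R"
    using M.I_maximal[OF sum(1,2)] sum(3) s(2) ideal.Icarr[OF sum(1)] by blast
  then have "\<one> \<in> P <+>\<^bsub>R\<^esub> PIdl s" by simp
  then obtain a z where az: "a \<in> P" "z \<in> PIdl s" "\<one> = a \<oplus> z"
    unfolding set_add_def' by blast
  then obtain t where t: "t \<in> carrier R" "z = t \<otimes> s"
    unfolding cgenideal_def by blast
  note a = az(1) t(1) az(3)[unfolded t(2)]
  have aR: "a \<in> carrier R" using a by simp
  have carr: "{a, p} \<subseteq> carrier R" using aR pR by simp
  \<comment> \<open>By \<open>a(3)\<close>, 1 - a = ts, and \<open>s\<close> multiplies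
    \<open>a\<close>, an element of \<open>P\<close>, into pR.\<close>
  have "a \<otimes> (\<one> \<ominus> a) = t \<otimes> (s \<otimes> a)"
    unfolding a(3) using aR a(2) s(1) by algebra
  then have "idempotent_pair R a p"
    using aR pR a(2) sP[OF a(1)] by (simp add: idempotent_pair_def p.I_l_closed)
  moreover have "P = Idl {a, p}"
  proof
    show "Idl {a, p} \<subseteq> P" using a p by (intro genideal_minimal P.is_ideal) simp
    interpret G: ideal "Idl {a, p}" R using carr by (rule genideal_ideal)
    have ap: "a \<in> Idl {a, p}" "p \<in> Idl {a, p}" using genideal_self[OF carr] by auto
    show "P \<subseteq> Idl {a, p}"
    proof
      fix q assume q: "q \<in> P"
      then have qR: "q \<in> carrier R" by simp
      have "s \<otimes> q \<in> Idl {a, p}"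
        using sP[OF q] cgenideal_minimal[OF G.is_ideal ap(2)] by blast
      \<comment> \<open>This element is \<open>q\<close> itself, multiplied by 1 = a + ts.\<close>
      then have "q \<otimes> a \<oplus> t \<otimes> (s \<otimes> q) \<in> Idl {a, p}"
        using G.a_closed G.I_l_closed ap(1) qR a(2) by blast
      moreover have "q \<otimes> a \<oplus> t \<otimes> (s \<otimes> q) = (a \<oplus> t \<otimes> s) \<otimes> q"
        using aR qR a(2) s(1) by algebra
      ultimately show "q \<in> Idl {a, p}" using qR by (simp flip: a(3))
    qed
  qed
  ultimately show ?thesis using that by blast
qed

section \<open>The equivalence\<close>

theorem corollary2p6:
  fixes R (structure)
  assumes "dedekind_domain R"
  shows "princ_domain R \<longleftrightarrow> principal_domain R"
proof
  interpret dedekind_domain R by fact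
  show "principal_domain R" if "princ_domain R"
  proof (rule principal_domain_if_primes_principal)
    interpret princ_domain R by fact
    fix P assume P: "primeideal P R"
    have "principalideal P R"
    proof (cases "P = {\<zero>}")
      case True
      then show ?thesis using zeropideal by simp
    next
      case False
      then show ?thesis using prime_idempotent_pair[OF P] princ by metis
    qed
    then show "\<exists>a\<in>carrier R. P = PIdl a"
      using principalideal.generate cgenideal_eq_genideal by metis
  qed
  show "princ_domain R" if "principal_domain R"
  proof (intro princ_domain.intro princ_domain_axioms.intro domain_axioms)
    interpret principal_domain R by fact
    fix a b assume "idempotent_pair R a b"
    then have "ideal (Idl {a, b}) R"
      by (intro genideal_ideal) (auto simp: idempotent_pair_def)
    then show "principalideal (Idl {a, b}) R"
      using exists_gen cgenideal_is_principalideal by metis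
  qed
qed

end
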